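(* Let $K\ge 1$, let $f_1$ be the pdf of $MSN(\mu_1,\Omega_1,\Lambda_1)$ on $\mathbb{R}^K$ (for some admissible parameters $\mu_1,\Omega_1,\Lambda_1$), and let $\Gamma_1$ be the value of $\Gamma$ for these parameters. Let $$\mathcal{P}_0=\{MSN(\mu,\Omega,\Lambda):\ \Gamma\neq\Gamma_1\},$$ where $(\mu,\Omega,\Lambda)$ ranges over all admissible parameters on $\mathbb{R}^K$. Then the family of mixture pdfs $\mathcal{F}(\mathcal{P}_0,f_1)$ is identifiable.
   Context: Multivariate skew normal family (MSN): for $\mu\in\mathbb{R}^K$, $\Omega$ a $K\times K$ (symmetric positive definite) covariance matrix and $\Lambda\in\mathbb{R}^K$, $MSN(\mu,\Omega,\Lambda)$ is the distribution on $\mathbb{R}^K$ with pdf $2\,\phi_K(x-\mu\,|\,\Omega)\,\Phi\left(\Lambda'\Omega^{-1/2}(x-\mu)\right)$, where $\phi_K(\cdot|\Omega)$ is the pdf of the $K$-dimensional normal distribution with mean zero and covariance $\Omega$, $\Phi$ is the standard univariate normal cdf, $'$ denotes transpose, and $\Omega^{1/2}$ is the symmetric positive definite square root. Distributions are identified with their pdfs. Associated quantities: $\delta=\Lambda/\sqrt{1+\Lambda'\Lambda}$, $\Delta=\Omega^{1/2}\delta$, $\Gamma=\Omega-\Delta\Delta'$. Mixtures with one known component: for a set $\mathcal{P}_0$ of pdfs on $\mathbb{R}^K$ and a fixed pdf $f_1$ on $\mathbb{R}^K$, put $f(\alpha,f_0)=\alpha f_1+(1-\alpha)f_0$ for $\alpha\in(0,1)$,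 $f_0\in\mathcal{P}_0$, and $\mathcal{F}(\mathcal{P}_0,f_1)=\{f(\alpha,f_0):\alpha\in(0,1),f_0\in\mathcal{P}_0\}$. The family $\mathcal{F}(\mathcal{P}_0,f_1)$ is identifiable if for all $a,b\in(0,1)$ and all $h_0,g_0\in\mathcal{P}_0$, $f(a,h_0)=f(b,g_0)$ implies $(a,h_0)=(b,g_0)$. *)

theory Defs
  imports "HOL-Probability.Probability"
begin

definition spd :: "real^'n^'n \<Rightarrow> bool" where
  "spd A \<longleftrightarrow> transpose A = A \<and> (\<forall>x. x \<noteq> 0 \<longrightarrow> 0 < x \<bullet> (A *v x))"

text \<open>The symmetric positive definite square root; meaningful only when \<^term>\<open>spd A\<close>,
  in which case such a root exists and is unique.\<close>

definition spd_sqrt :: "real^'n^'n \<Rightarrow> real^'n^'n" where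
  "spd_sqrt A = (THE B. spd B \<and> B ** B = A)"

definition mvn_density :: "real^'n^'n \<Rightarrow> real^'n \<Rightarrow> real" where
  "mvn_density \<Omega> x =
     exp (- (x \<bullet> (matrix_inv \<Omega> *v x)) / 2) / sqrt ((2 * pi) ^ CARD('n) * det \<Omega>)"

definition msn_density :: "real^'n \<Rightarrow> real^'n^'n \<Rightarrow> real^'n \<Rightarrow> real^'n \<Rightarrow> real" where
  "msn_density \<mu> \<Omega> \<Lambda> x =
     2 * mvn_density \<Omega> (x - \<mu>) *
     cdf std_normal_distribution (\<Lambda> \<bullet> (matrix_inv (spd_sqrt \<Omega>) *v (x - \<mu>)))"

definition msn_delta :: "real^'n \<Rightarrow> real^'n" where
  "msn_delta \<Lambda> = (1 / sqrt (1 + \<Lambda> \<bullet> \<Lambda>)) *\<^sub>R \<Lambda>"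

definition msn_Delta :: "real^'n^'n \<Rightarrow> real^'n \<Rightarrow> real^'n" where
  "msn_Delta \<Omega> \<Lambda> = spd_sqrt \<Omega> *v msn_delta \<Lambda>"

definition msn_Gamma :: "real^'n^'n \<Rightarrow> real^'n \<Rightarrow> real^'n^'n" where
  "msn_Gamma \<Omega> \<Lambda> = \<Omega> - (\<chi> i j. msn_Delta \<Omega> \<Lambda> $ i * msn_Delta \<Omega> \<Lambda> $ j)"

definition mixture :: "('a \<Rightarrow> real) \<Rightarrow> real \<Rightarrow> ('a \<Rightarrow> real) \<Rightarrow> 'a \<Rightarrow> real" where
  "mixture f1 \<alpha> f0 = (\<lambda>x. \<alpha> * f1 x + (1 - \<alpha>) * f0 x)"

text \<open>Identifiability of the family of all \<^term>\<open>mixture f1 \<alpha> f0\<close> with \<open>0 < \<alpha> < 1\<close> and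
  \<open>f0 \<in> P0\<close>. It is a property of the parametrization \<open>(\<alpha>, f0) \<mapsto> mixture f1 \<alpha> f0\<close>, not of
  its range, so it takes \<open>P0\<close> and \<open>f1\<close> as arguments.\<close>

definition identifiable :: "('a \<Rightarrow> real) set \<Rightarrow> ('a \<Rightarrow> real) \<Rightarrow> bool" where
  "identifiable P0 f1 \<longleftrightarrow>
     (\<forall>a\<in>{0<..<1}. \<forall>b\<in>{0<..<1}. \<forall>h0\<in>P0. \<forall>g0\<in>P0.
        mixture f1 a h0 = mixture f1 b g0 \<longrightarrow> (a, h0) = (b, g0))"

end

theory Submission
  imports Defs "HOL-Real_Asymp.Real_Asymp"
begin

text \<open>If two different mixtures agreed, some skew normal density would be a positive combination
  of \<open>f1\<close> and another skew normal density, where both other densities have \<open>\<Gamma>\<close> different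
  from \<open>\<Gamma>1\<close>. One computes \<open>\<Gamma>\<inverse> = \<Omega>\<inverse> + \<eta>\<eta>'\<close> with \<open>\<eta> = \<Omega>\<^bsup>-1/2\<^esup>\<Lambda>\<close>, so along a line with a
  generic direction \<open>v\<close> the densities become \<open>exp(- p t\<^sup>2/2 + l t + k) \<Phi>(e t + d)\<close>, where
  \<open>p + e\<^sup>2 = v'\<Gamma>\<inverse>v\<close> for the first one differs from the values for the two others. Comparing the
  leading terms at both ends of the line (by Mills' ratio the density decays with rate \<open>p\<close> where
  \<open>e t \<rightarrow> \<infinity>\<close>, and with rate \<open>p + e\<^sup>2\<close> and an additional factor \<open>1/t\<close> where \<open>e t \<rightarrow> -\<infinity>\<close>) forces
  the right-hand side to share its Gaussian factor with a summand. Then the other summand is this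
  Gaussian times a difference of two values of \<open>\<Phi>\<close>, and its tails have the wrong rate.\<close>

section \<open>The standard normal distribution function\<close>

abbreviation std_normal_cdf :: "real \<Rightarrow> real" where
  "std_normal_cdf \<equiv> cdf std_normal_distribution"

interpretation std_normal: real_distribution std_normal_distribution
  by (rule real_dist_normal_dist)

lemma std_normal_cdf_diff:
  assumes "a < b"
  shows "std_normal_cdf b - std_normal_cdf a = integral {a..b} std_normal_density"
proof -
  have int: "set_integrable lborel {a..b} std_normal_density"
    by (rule borel_integrable_atLeastAtMost') (auto intro!: continuous_intros simp: normal_density_def[abs_def])
  have "measure std_normal_distribution {a<..b} = (LINT x|lborel. indicator {a<..b} x * std_normal_density x)"
  proof -
    have "emeasure std_normal_distribution {a<..b} =
        (\<integral>\<^sup>+x. ennreal (indicator {a<..b} x * std_normal_density x) \<partial>lborel)"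
      by (subst emeasure_density) (auto intro!: nn_integral_cong simp: indicator_def)
    then show ?thesis
      by (subst integral_eq_nn_integral) (auto simp: measure_def)
  qed
  also have "\<dots> = (LINT x:{a..b}|lborel. std_normal_density x)"
    unfolding set_lebesgue_integral_def
    by (intro integral_cong_AE, simp, simp) (use AE_lborel_singleton[of a] in eventually_elim, auto simp: indicator_def)
  also have "\<dots> = integral {a..b} std_normal_density"
    by (rule set_borel_integral_eq_integral(2)[OF int])
  finally show ?thesis
    using std_normal.cdf_diff_eq[OF assms] by simp
qed

text \<open>Near \<open>x\<close> the distribution function is its value at \<open>x - 1\<close>
  plus the integral of the continuous density, so the fundamental theorem of calculus applies; the
  window around \<open>x\<close> only has to contain \<open>x\<close> in its interior.\<close>

lemma DERIV_std_normal_cdf: "DERIV std_normal_cdf x :> std_normal_density x"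
proof -
  let ?a = "x - 1" and ?b = "x + 1"
  have "((\<lambda>u. integral {?a..u} std_normal_density) has_vector_derivative std_normal_density x) (at x within {?a..?b})"
    by (rule integral_has_vector_derivative)
       (auto intro!: continuous_intros simp: normal_density_def[abs_def])
  then have "((\<lambda>u. integral {?a..u} std_normal_density) has_vector_derivative std_normal_density x) (at x)"
    by (subst (asm) at_within_interior) auto
  then have "((\<lambda>u. std_normal_cdf ?a + integral {?a..u} std_normal_density) has_real_derivative std_normal_density x) (at x)"
    by (auto simp: has_real_derivative_iff_has_vector_derivative intro!: derivative_eq_intros)
  then show ?thesis
  proof (rule has_field_derivative_transform_within_open[where S="{?a<..<?b}"])
    fix u assume "u \<in> {?a<..<?b}"
    then show "std_normal_cdf ?a + integral {?a..u} std_normal_density = std_normal_cdf u"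
      using std_normal_cdf_diff[of ?a u] by auto
  qed auto
qed

lemma std_normal_cdf_strict_mono: "a < b \<Longrightarrow> std_normal_cdf a < std_normal_cdf b"
  by (rule DERIV_pos_imp_increasing) (auto intro!: DERIV_std_normal_cdf normal_density_pos)

lemma std_normal_cdf_pos: "0 < std_normal_cdf x"
  using std_normal_cdf_strict_mono[of "x - 1" x] std_normal.cdf_nonneg[of "x - 1"] by simp

lemma std_normal_cdf_less_1: "std_normal_cdf x < 1"
  using std_normal_cdf_strict_mono[of x "x + 1"] std_normal.cdf_bounded_prob[of "x + 1"] by simp

text \<open>The density is even, so \<open>h\<close> has derivative zero; its constant value is its
  limit 1 at infinity.\<close>

lemma std_normal_cdf_minus: "std_normal_cdf (- x) = 1 - std_normal_cdf x"
proof -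
  define h where "h = (\<lambda>x. std_normal_cdf x + std_normal_cdf (- x))"
  have "DERIV h x :> 0" for x
    unfolding h_def
    by (rule DERIV_cong,
        (rule DERIV_std_normal_cdf derivative_intros DERIV_chain2[OF DERIV_std_normal_cdf])+)
       (simp add: normal_density_def)
  then have const: "h x = h y" for x y
    using DERIV_const_ratio_const[of _ _ h 0] by (metis DERIV_isconst_all)
  have "(h \<longlongrightarrow> 1 + 0) at_top"
    unfolding h_def
    by (intro tendsto_add std_normal.cdf_lim_at_top_prob
        filterlim_compose[OF std_normal.cdf_lim_at_bot] filterlim_uminus_at_bot_at_top)
  moreover have "(h \<longlongrightarrow> h x) at_top"
    using const by (metis (mono_tags) tendsto_const tendsto_cong eventually_at_top_linorder)
  ultimately have "h x = 1"
    using tendsto_unique[OF trivial_limit_at_top_linorder] by fastforce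
  then show ?thesis by (simp add: h_def)
qed

text \<open>Mills' ratio, by l'Hopital's rule after the substitution of \<open>1 / x\<close> for the
  variable, which moves the limit to 0 from the right. There \<open>g\<close> is the density at
  \<open>1 / x\<close> divided by \<open>1 / x\<close>, and the derivatives have the quotient
  \<open>(1 / x^2) / (1 + 1 / x^2)\<close>.\<close>

lemma std_normal_cdf_tail:
  "((\<lambda>x. x * sqrt (2 * pi) * exp (x\<^sup>2 / 2) * std_normal_cdf (- x)) \<longlongrightarrow> 1) at_top"
proof -
  define c where "c = sqrt (2 * pi)"
  have c: "c > 0" by (simp add: c_def)
  define g where "g = (\<lambda>x::real. x * exp (- (1 / x)\<^sup>2 / 2) / c)"
  define g' where "g' = (\<lambda>x::real. exp (- (1 / x)\<^sup>2 / 2) * (1 + 1 / x\<^sup>2) / c)"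
  define f' where "f' = (\<lambda>x::real. exp (- (1 / x)\<^sup>2 / 2) / c / x\<^sup>2)"
  have "((\<lambda>x. std_normal_cdf (- (1 / x)) / g x) \<longlongrightarrow> 1) (at_right 0)"
  proof (rule lhopital_right_0[where f' = f' and g' = g'])
    have "filterlim (\<lambda>x::real. - (1 / x)) at_bot (at_right 0)"
      by real_asymp
    then show "((\<lambda>x. std_normal_cdf (- (1 / x))) \<longlongrightarrow> 0) (at_right 0)"
      by (rule filterlim_compose[OF std_normal.cdf_lim_at_bot])
    have "((\<lambda>x::real. x * exp (- (1 / x)\<^sup>2 / 2)) \<longlongrightarrow> 0) (at_right 0)"
      by real_asymp
    then show "(g \<longlongrightarrow> 0) (at_right 0)"
      unfolding g_def by (rule tendsto_divide_zero)
    show "\<forall>\<^sub>F x in at_right 0. g x \<noteq> 0"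
      unfolding g_def using c by (auto simp: eventually_at_filter)
    show "\<forall>\<^sub>F x in at_right 0. g' x \<noteq> 0"
      unfolding g'_def using c by (auto simp: eventually_at_filter add_nonneg_eq_0_iff)
    show "\<forall>\<^sub>F x in at_right 0. DERIV (\<lambda>x. std_normal_cdf (- (1 / x))) x :> f' x"
    proof (rule eventually_mono[OF eventually_at_right_less[of 0]])
      fix x :: real assume "0 < x"
      then show "DERIV (\<lambda>x. std_normal_cdf (- (1 / x))) x :> f' x"
        unfolding f'_def
        by (intro DERIV_cong[OF DERIV_chain2[OF DERIV_std_normal_cdf, of "\<lambda>x. - (1 / x)" "1 / x\<^sup>2"]])
           (auto intro!: derivative_eq_intros simp: std_normal_density_def c_def field_simps power2_eq_square)
    qed
    show "\<forall>\<^sub>F x in at_right 0. DERIV g x :> g' x"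
    proof (rule eventually_mono[OF eventually_at_right_less[of 0]])
      fix x :: real assume "0 < x"
      then show "DERIV g x :> g' x"
        unfolding g'_def g_def using c
        by (auto intro!: derivative_eq_intros simp: field_simps power2_eq_square)
    qed
    have "((\<lambda>x::real. (1 / x\<^sup>2) / (1 + 1 / x\<^sup>2)) \<longlongrightarrow> 1) (at_right 0)"
      by real_asymp
    moreover have "f' x / g' x = (1 / x\<^sup>2) / (1 + 1 / x\<^sup>2)" for x
    proof -
      have "f' x = exp (- (1 / x)\<^sup>2 / 2) / c * (1 / x\<^sup>2)" "g' x = exp (- (1 / x)\<^sup>2 / 2) / c * (1 + 1 / x\<^sup>2)"
        by (simp_all add: f'_def g'_def)
      then show ?thesis using c by (simp only: mult_divide_mult_cancel_left_if) simp
    qed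
    ultimately show "((\<lambda>x. f' x / g' x) \<longlongrightarrow> 1) (at_right 0)"
      by simp
  qed
  then have "((\<lambda>x. std_normal_cdf (- x) / g (1 / x)) \<longlongrightarrow> 1) at_top"
    by (simp add: filterlim_at_right_to_top inverse_eq_divide)
  then show ?thesis
    unfolding g_def c_def by (simp add: exp_minus field_simps)
qed

section \<open>Skew normal densities on a line\<close>

fun tail_term :: "real \<times> real \<times> real \<Rightarrow> real \<Rightarrow> real \<Rightarrow> real" where
  "tail_term (r, m, s) c t = exp (- r / 2 * t\<^sup>2 + m * t - s * ln t + c)"

text \<open>The lexicographic order of growth on keys: slower Gaussian decay first, then the larger
  linear term, then the smaller power of \<open>1/t\<close>. That power is written through
  \<open>ln t\<close> in \<open>tail_term\<close>, so that every scale function is a single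
  exponential, positive for all \<open>t\<close>.\<close>

fun dominates :: "real \<times> real \<times> real \<Rightarrow> real \<times> real \<times> real \<Rightarrow> bool" where
  "dominates (r, m, s) (r', m', s') \<longleftrightarrow> r < r' \<or> r = r' \<and> (m > m' \<or> m = m' \<and> s < s')"

lemma dominates_cases: "dominates a b \<or> a = b \<or> dominates b a"
  by (cases a; cases b) auto

lemma tail_term_pos: "0 < tail_term a c t"
  by (cases a) simp

text \<open>The quotient is one exponential, and dominance says that the leading nonzero coefficient
  among those of \<open>t^2\<close>, \<open>t\<close> and \<open>ln t\<close> is positive.\<close>

lemma tail_term_ratio_at_top:
  assumes "dominates a b"
  shows "filterlim (\<lambda>t. tail_term a c t / tail_term b c' t) at_top at_top"
proof -
  obtain r m s where a: "a = (r, m, s)" by (cases a)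
  obtain r' m' s' where b: "b = (r', m', s')" by (cases b)
  define R M S C where "R = r' - r" and "M = m - m'" and "S = s' - s" and "C = c - c'"
  have eq: "tail_term a c t / tail_term b c' t = exp (R / 2 * t\<^sup>2 + M * t + S * ln t + C)" for t
  proof -
    have "- r / 2 * t\<^sup>2 + m * t - s * ln t + c - (- r' / 2 * t\<^sup>2 + m' * t - s' * ln t + c')
        = R / 2 * t\<^sup>2 + M * t + S * ln t + C"
      unfolding R_def M_def S_def C_def by (simp add: left_diff_distrib diff_divide_distrib)
    then show ?thesis by (simp only: a b tail_term.simps flip: exp_diff)
  qed
  consider "R > 0" | "R = 0" "M > 0" | "R = 0" "M = 0" "S > 0"
    using assms by (auto simp: a b R_def M_def S_def)
  then show ?thesis
    unfolding eq
  proof cases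
    case 1
    then show "filterlim (\<lambda>t. exp (R / 2 * t\<^sup>2 + M * t + S * ln t + C)) at_top at_top"
      by real_asymp
  next
    case 2
    then show "filterlim (\<lambda>t. exp (R / 2 * t\<^sup>2 + M * t + S * ln t + C)) at_top at_top"
      by simp real_asymp
  next
    case 3
    then show "filterlim (\<lambda>t. exp (R / 2 * t\<^sup>2 + M * t + S * ln t + C)) at_top at_top"
      by simp real_asymp
  qed
qed

lemma tail_term_ratio_tendsto_0:
  assumes "dominates b a"
  shows "((\<lambda>t. tail_term a c t / tail_term b c' t) \<longlongrightarrow> 0) at_top"
  using tendsto_inverse_0_at_top[OF tail_term_ratio_at_top[OF assms, of c' c]]
  by simp

lemma tail_term_ratio_same: "tail_term a c t / tail_term a c' t = exp (c - c')"
  by (cases a) (simp flip: exp_diff)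

text \<open>Positive summands cannot cancel, so the leading term of the sum is the larger of the two
  leading terms. If only one summand has the key of the sum, then it has its constant as well; if
  both have it, nothing is said about the constants.\<close>

lemma tail_term_sum:
  assumes f1: "((\<lambda>t. f1 t / tail_term a1 c1 t) \<longlongrightarrow> 1) at_top" and pos1: "\<And>t. f1 t > 0"
    and f2: "((\<lambda>t. f2 t / tail_term a2 c2 t) \<longlongrightarrow> 1) at_top" and pos2: "\<And>t. f2 t > 0"
    and sum: "((\<lambda>t. (f1 t + f2 t) / tail_term a3 c3 t) \<longlongrightarrow> 1) at_top"
  shows "dominates a3 a1 \<and> a2 = a3 \<and> c2 = c3 \<or> dominates a3 a2 \<and> a1 = a3 \<and> c1 = c3 \<or> a1 = a3 \<and> a2 = a3"
proof -
  \<comment> \<open>A summand dominating \<open>a3\<close> would push the whole normalised sum to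
    infinity, since the other summand is positive.\<close>
  have no_blowup: "\<not> dominates a a3"
    if f: "((\<lambda>t. f t / tail_term a c t) \<longlongrightarrow> 1) at_top" and pos: "\<And>t. g t > 0"
      and sum: "((\<lambda>t. (f t + g t) / tail_term a3 c3 t) \<longlongrightarrow> 1) at_top"
    for f g :: "real \<Rightarrow> real" and a c
  proof
    assume "dominates a a3"
    then have A: "filterlim (\<lambda>t. f t / tail_term a c t * (tail_term a c t / tail_term a3 c3 t)) at_top at_top"
      by (intro filterlim_tendsto_pos_mult_at_top[OF f] tail_term_ratio_at_top) auto
    have B: "f t / tail_term a c t * (tail_term a c t / tail_term a3 c3 t) \<le> (f t + g t) / tail_term a3 c3 t" for t
      using tail_term_pos[of a c t] tail_term_pos[of a3 c3 t] pos[of t] by (simp add: divide_right_mono less_imp_le)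
    have "filterlim (\<lambda>t. (f t + g t) / tail_term a3 c3 t) at_top at_top"
      by (rule filterlim_at_top_mono[OF A always_eventually[OF allI[OF B]]])
    then show False
      using not_tendsto_and_filterlim_at_infinity[OF _ sum] filterlim_at_top_imp_at_infinity
      by (metis trivial_limit_at_top_linorder)
  qed
  \<comment> \<open>The dominated summand disappears in the limit, so the normalised sum tends to
    \<open>exp (c' - c3)\<close>, which must be 1.\<close>
  have vanish: "c' = c3"
    if f: "((\<lambda>t. f t / tail_term a c t) \<longlongrightarrow> 1) at_top"
      and g: "((\<lambda>t. g t / tail_term a3 c' t) \<longlongrightarrow> 1) at_top"
      and dom: "dominates a3 a"
      and sum: "((\<lambda>t. (f t + g t) / tail_term a3 c3 t) \<longlongrightarrow> 1) at_top"
    for f g :: "real \<Rightarrow> real" and a c c'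
  proof -
    have "((\<lambda>t. f t / tail_term a c t * (tail_term a c t / tail_term a3 c3 t) + g t / tail_term a3 c' t * (tail_term a3 c' t / tail_term a3 c3 t))
            \<longlongrightarrow> 1 * 0 + 1 * exp (c' - c3)) at_top"
      unfolding tail_term_ratio_same
      by (intro tendsto_intros f g tail_term_ratio_tendsto_0 dom)
    moreover have "f t / tail_term a c t * (tail_term a c t / tail_term a3 c3 t) + g t / tail_term a3 c' t * (tail_term a3 c' t / tail_term a3 c3 t)
        = (f t + g t) / tail_term a3 c3 t" for t
      using tail_term_pos[of a c t] tail_term_pos[of a3 c3 t] tail_term_pos[of a3 c' t] by (simp add: add_divide_distrib)
    ultimately have "exp (c' - c3) = 1"
      using tendsto_unique[OF trivial_limit_at_top_linorder _ sum] by fastforce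
    then show ?thesis by simp
  qed
  have both: "\<not> (dominates a3 a1 \<and> dominates a3 a2)"
  proof
    assume "dominates a3 a1 \<and> dominates a3 a2"
    then have "((\<lambda>t. f1 t / tail_term a1 c1 t * (tail_term a1 c1 t / tail_term a3 c3 t) + f2 t / tail_term a2 c2 t * (tail_term a2 c2 t / tail_term a3 c3 t))
            \<longlongrightarrow> 1 * 0 + 1 * 0) at_top"
      by (intro tendsto_intros f1 f2 tail_term_ratio_tendsto_0) auto
    moreover have "f1 t / tail_term a1 c1 t * (tail_term a1 c1 t / tail_term a3 c3 t) + f2 t / tail_term a2 c2 t * (tail_term a2 c2 t / tail_term a3 c3 t)
        = (f1 t + f2 t) / tail_term a3 c3 t" for t
      using tail_term_pos[of a1 c1 t] tail_term_pos[of a3 c3 t] tail_term_pos[of a2 c2 t] by (simp add: add_divide_distrib)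
    ultimately show False
      using tendsto_unique[OF trivial_limit_at_top_linorder _ sum] by fastforce
  qed
  have sum': "((\<lambda>t. (f2 t + f1 t) / tail_term a3 c3 t) \<longlongrightarrow> 1) at_top"
    using sum by (simp add: add.commute)
  have "c2 = c3" if "dominates a3 a1" "a2 = a3"
    using vanish[OF f1 f2[unfolded that(2)] that(1) sum] .
  moreover have "c1 = c3" if "dominates a3 a2" "a1 = a3"
    using vanish[OF f2 f1[unfolded that(2)] that(1) sum'] .
  ultimately show ?thesis
    using no_blowup[OF f1 pos2 sum] no_blowup[OF f2 pos1 sum'] both
      dominates_cases[of a1 a3] dominates_cases[of a2 a3] by metis
qed

lemma tail_term_unique:
  assumes f: "((\<lambda>t. f t / tail_term a c t) \<longlongrightarrow> 1) at_top"
    and f': "((\<lambda>t. f t / tail_term a' c' t) \<longlongrightarrow> 1) at_top"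
  shows "a = a'"
proof -
  have no: False if f: "((\<lambda>t. f t / tail_term a c t) \<longlongrightarrow> 1) at_top"
    and f': "((\<lambda>t. f t / tail_term a' c' t) \<longlongrightarrow> 1) at_top" and dom: "dominates a' a" for a c a' c'
  proof -
    have "((\<lambda>t. f t / tail_term a c t * (tail_term a c t / tail_term a' c' t)) \<longlongrightarrow> 1 * 0) at_top"
      by (intro tendsto_intros f tail_term_ratio_tendsto_0 dom)
    moreover have "(\<lambda>t. f t / tail_term a c t * (tail_term a c t / tail_term a' c' t)) = (\<lambda>t. f t / tail_term a' c' t)"
      using tail_term_pos[of a c] by (simp add: less_imp_neq[THEN not_sym])
    ultimately show False
      using tendsto_unique[OF trivial_limit_at_top_linorder _ f'] by fastforce
  qed
  show ?thesis using no[OF f f'] no[OF f' f] dominates_cases[of a a'] by blast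
qed

text \<open>The restriction of a skew normal density to a line, up to a constant factor. For slope
  \<open>e = 0\<close> the constant value of the distribution function is absorbed into \<open>k\<close>.\<close>

definition skew_line :: "real \<Rightarrow> real \<Rightarrow> real \<Rightarrow> real \<Rightarrow> real \<Rightarrow> real \<Rightarrow> real" where
  "skew_line p l k e d t =
     exp (- p / 2 * t\<^sup>2 + l * t + k) * (if e = 0 then 1 else std_normal_cdf (e * t + d))"

text \<open>For \<open>e < 0\<close> Mills' ratio replaces the distribution function by
  \<open>exp (- (e * t + d)^2 / 2) / (- e * t * sqrt (2 * pi))\<close>. Expanding the square adds
  \<open>e^2\<close> to the rate and \<open>- e * d\<close> to the linear coefficient, and
  \<open>1/t\<close> gives the last entry 1; the remaining constants form \<open>tail_const\<close>.
  For \<open>e \<ge> 0\<close> the last factor tends to 1.\<close>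

definition tail_key :: "real \<Rightarrow> real \<Rightarrow> real \<Rightarrow> real \<Rightarrow> real \<times> real \<times> real" where
  "tail_key p l e d = (if e < 0 then (p + e\<^sup>2, l - e * d, 1) else (p, l, 0))"

definition tail_const :: "real \<Rightarrow> real \<Rightarrow> real \<Rightarrow> real" where
  "tail_const k e d = (if e < 0 then k - d\<^sup>2 / 2 - ln (- e) - ln (2 * pi) / 2 else k)"

lemma skew_line_pos: "0 < skew_line p l k e d t"
  by (simp add: skew_line_def std_normal_cdf_pos)

text \<open>This turns the behaviour at minus infinity into that at infinity.\<close>

lemma skew_line_reflect: "skew_line p l k e d (- t) = skew_line p (- l) k (- e) d t"
  by (simp add: skew_line_def)

lemma skew_line_tail:
  "((\<lambda>t. skew_line p l k e d t / tail_term (tail_key p l e d) (tail_const k e d) t) \<longlongrightarrow> 1) at_top"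
proof -
  consider "e = 0" | "e > 0" | "e < 0" by linarith
  then show ?thesis
  proof cases
    case 1
    then show ?thesis by (simp add: skew_line_def tail_key_def tail_const_def)
  next
    case 2
    then have "filterlim (\<lambda>t. e * t + d) at_top at_top" by real_asymp
    then have "((\<lambda>t. std_normal_cdf (e * t + d)) \<longlongrightarrow> 1) at_top"
      by (rule filterlim_compose[OF std_normal.cdf_lim_at_top_prob])
    then show ?thesis using 2 by (simp add: skew_line_def tail_key_def tail_const_def)
  next
    case 3
    define x where "x = (\<lambda>t. - (e * t + d))"
    have x: "filterlim x at_top at_top" unfolding x_def using 3 by real_asymp
    have "((\<lambda>t. x t * sqrt (2 * pi) * exp ((x t)\<^sup>2 / 2) * std_normal_cdf (- x t)) \<longlongrightarrow> 1) at_top"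
      by (rule filterlim_compose[OF std_normal_cdf_tail x])
    \<comment> \<open>Mills' ratio yields the factor \<open>1 / x t\<close>; this quotient exchanges
      it for a multiple of \<open>1 / t\<close>, as the scale requires.\<close>
    moreover have "((\<lambda>t. - e * t / x t) \<longlongrightarrow> 1) at_top"
      unfolding x_def using 3 by real_asymp
    ultimately have "((\<lambda>t. x t * sqrt (2 * pi) * exp ((x t)\<^sup>2 / 2) * std_normal_cdf (- x t) * (- e * t / x t)) \<longlongrightarrow> 1) at_top"
      using tendsto_mult by fastforce
    moreover have "\<forall>\<^sub>F t in at_top. x t * sqrt (2 * pi) * exp ((x t)\<^sup>2 / 2) * std_normal_cdf (- x t) * (- e * t / x t) =
        skew_line p l k e d t / tail_term (tail_key p l e d) (tail_const k e d) t"
      using eventually_gt_at_top[of 0] eventually_compose_filterlim[OF eventually_gt_at_top[of 0] x]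
    proof eventually_elim
      case (elim t)
      have sq: "sqrt (2 * pi) = exp (ln (2 * pi) / 2)"
        by (simp add: exp_ln_iff flip: ln_sqrt)
      have et: "- e * t = exp (ln (- e) + ln t)"
        using 3 elim by (simp add: exp_add)
      have expo: "ln (2 * pi) / 2 + (x t)\<^sup>2 / 2 + (ln (- e) + ln t) =
          (- p / 2 * t\<^sup>2 + l * t + k) - (- (p + e\<^sup>2) / 2 * t\<^sup>2 + (l - e * d) * t - 1 * ln t + tail_const k e d)"
        using 3 by (simp add: tail_const_def x_def power2_eq_square field_simps)
      have "x t * sqrt (2 * pi) * exp ((x t)\<^sup>2 / 2) * std_normal_cdf (- x t) * (- e * t / x t)
          = sqrt (2 * pi) * exp ((x t)\<^sup>2 / 2) * (- e * t) * std_normal_cdf (- x t)"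
        using elim by simp
      also have "\<dots> = exp (ln (2 * pi) / 2 + (x t)\<^sup>2 / 2 + (ln (- e) + ln t)) * std_normal_cdf (- x t)"
        unfolding sq et by (simp only: exp_add)
      also have "\<dots> = skew_line p l k e d t / tail_term (tail_key p l e d) (tail_const k e d) t"
        using 3 unfolding expo exp_diff by (simp add: skew_line_def tail_key_def x_def add.commute)
      finally show ?case .
    qed
    ultimately show ?thesis by (rule Lim_transform_eventually)
  qed
qed

section \<open>Sums of two skew lines\<close>

lemma skew_line_sum_tail:
  assumes "\<And>t. skew_line p1 l1 k1 e1 d1 t + skew_line p2 l2 k2 e2 d2 t = skew_line p3 l3 k3 e3 d3 t"
  defines "a1 \<equiv> tail_key p1 l1 e1 d1" and "a2 \<equiv> tail_key p2 l2 e2 d2" and "a3 \<equiv> tail_key p3 l3 e3 d3"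
  defines "c1 \<equiv> tail_const k1 e1 d1" and "c2 \<equiv> tail_const k2 e2 d2" and "c3 \<equiv> tail_const k3 e3 d3"
  shows "dominates a3 a1 \<and> a2 = a3 \<and> c2 = c3 \<or> dominates a3 a2 \<and> a1 = a3 \<and> c1 = c3 \<or> a1 = a3 \<and> a2 = a3"
  unfolding assms(2-)
  by (rule tail_term_sum[OF skew_line_tail skew_line_pos skew_line_tail skew_line_pos])
     (use skew_line_tail assms(1) in simp)

lemma skew_line_sum_reflect:
  assumes "\<And>t. skew_line p1 l1 k1 e1 d1 t + skew_line p2 l2 k2 e2 d2 t = skew_line p3 l3 k3 e3 d3 t"
  shows "skew_line p1 (- l1) k1 (- e1) d1 t + skew_line p2 (- l2) k2 (- e2) d2 t
       = skew_line p3 (- l3) k3 (- e3) d3 t"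
  using assms[of "- t"] by (simp add: skew_line_reflect)

lemma skew_line_complement:
  assumes "e \<noteq> 0"
  shows "skew_line p l k (- e) (- d) t = exp (- p / 2 * t\<^sup>2 + l * t + k) - skew_line p l k e d t"
  using assms std_normal_cdf_minus[of "e * t + d"]
  by (simp add: skew_line_def right_diff_distrib)

text \<open>Equal functions have equal keys at both ends. The last entries show that the slopes have
  the same sign; the rate \<open>p + e^2\<close> is visible at the end with last entry 1, or at
  either end if the slope is zero.\<close>

lemma skew_line_eq_imp_rate_eq:
  assumes eq: "\<And>t. skew_line p l k e d t = skew_line p' l' k' e' d' t"
  shows "p + e\<^sup>2 = p' + e'\<^sup>2"
proof -
  have unique: "tail_key p l e d = tail_key p' l' e' d'"
    if "\<And>t. skew_line p l k e d t = skew_line p' l' k' e' d' t" for l e l' e'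
    using skew_line_tail[of p l k e d] skew_line_tail[of p' l' k' e' d']
    unfolding that by (rule tail_term_unique)
  have "skew_line p (- l) k (- e) d t = skew_line p' (- l') k' (- e') d' t" for t
    using eq[of "- t"] by (simp only: skew_line_reflect)
  from unique[OF this] unique[OF eq] show ?thesis
    by (auto simp: tail_key_def split: if_splits)
qed


text \<open>The first summand is the common Gaussian times a difference of two values of \<Phi>, or
  of 1 and a value of \<Phi>. Such a difference decays like a tail of \<Phi>.\<close>

lemma skew_line_sum_same_gauss:
  assumes sum: "\<And>t. skew_line p1 l1 k1 e1 d1 t + skew_line p l k e2 d2 t = skew_line p l k e3 d3 t"
  shows "p1 + e1\<^sup>2 = p + e2\<^sup>2"
proof -
  have less: "skew_line p l k e2 d2 t < skew_line p l k e3 d3 t" for t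
    using sum[of t] skew_line_pos[of p1 l1 k1 e1 d1 t] by linarith
  \<comment> \<open>For \<open>e2 = 0\<close> the second summand would be the full Gaussian, which
    the right-hand side cannot exceed.\<close>
  have e2: "e2 \<noteq> 0"
    using less[of 0] std_normal_cdf_less_1[of d3] by (auto simp: skew_line_def split: if_splits)
  show ?thesis
  proof (cases "e3 = 0")
    case True
    have "skew_line p1 l1 k1 e1 d1 t = skew_line p l k (- e2) (- d2) t" for t
      using sum[of t] skew_line_complement[OF e2, of p l k d2 t] True by (simp add: skew_line_def)
    then show ?thesis
      using skew_line_eq_imp_rate_eq[of p1 l1 k1 e1 d1 p l k "- e2" "- d2"] by simp
  next
    case False
    \<comment> \<open>Monotonicity of \<Phi> transfers the inequality to the affine arguments; on
      all of the real line it can only hold between parallel lines.\<close>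
    have lin: "e2 * t + d2 < e3 * t + d3" for t
    proof (rule ccontr)
      assume "\<not> ?thesis"
      then have "std_normal_cdf (e3 * t + d3) \<le> std_normal_cdf (e2 * t + d2)"
        by (intro std_normal.cdf_nondecreasing) simp
      then show False using less[of t] e2 False by (simp add: skew_line_def)
    qed
    have e3: "e3 = e2"
    proof (rule ccontr)
      assume "e3 \<noteq> e2"
      moreover define t where "t = (d2 - d3) / (e3 - e2)"
      ultimately have "(e3 - e2) * t = d2 - d3" by simp
      then show False using lin[of t] by (simp add: left_diff_distrib)
    qed
    have d: "d2 \<noteq> d3" using lin[of 0] by simp
    \<comment> \<open>Passing to complements negates the slope and exchanges the two sides, so one
      of \<open>sum\<close> and \<open>sum'\<close> has a negative slope whatever the sign of
      \<open>e2\<close>.\<close>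
    have sum': "skew_line p1 l1 k1 e1 d1 t + skew_line p l k (- e2) (- d3) t = skew_line p l k (- e2) (- d2) t" for t
      using sum[of t] e2 unfolding e3 by (simp add: skew_line_complement)
    \<comment> \<open>For \<open>x \<noteq> y\<close> the second summand and the right-hand side
      have keys with different linear coefficients, so the first summand must have the key of the
      right-hand side.\<close>
    have rate: "fst (tail_key p1 l1 e1 d1) = p + n\<^sup>2"
      if "\<And>t. skew_line p1 l1 k1 e1 d1 t + skew_line p l k n x t = skew_line p l k n y t"
        and "n < 0" and "x \<noteq> y" for l1 e1 l n x y
      using skew_line_sum_tail[OF that(1)] that(2,3) by (auto simp: tail_key_def)
    \<comment> \<open>The first summand is shown to decay with rate \<open>p + e2^2\<close> at both
      ends, and one end exhibits \<open>p1 + e1^2\<close>.\<close>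
    have "fst (tail_key p1 l1 e1 d1) = p + e2\<^sup>2"
      using rate[OF sum[unfolded e3]] rate[OF sum'] d e2 by (cases "e2 < 0") auto
    moreover have "fst (tail_key p1 (- l1) (- e1) d1) = p + e2\<^sup>2"
      using rate[OF skew_line_sum_reflect[OF sum[unfolded e3]]] rate[OF skew_line_sum_reflect[OF sum']] d e2
      by (cases "e2 < 0") auto
    ultimately show ?thesis
      by (auto simp: tail_key_def split: if_splits)
  qed
qed

text \<open>The keys at both ends are compared for each sign pattern of the slopes. A key with last
  entry 1 exposes \<open>p + e^2\<close>, so by the rate hypotheses the first summand shares no such
  key with another term. Reflection later covers \<open>e1 > 0\<close>.\<close>

lemma skew_line_sum_gauss_cases:
  assumes sum: "\<And>t. skew_line p1 l1 k1 e1 d1 t + skew_line p2 l2 k2 e2 d2 t = skew_line p3 l3 k3 e3 d3 t"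
    and ne2: "p1 + e1\<^sup>2 \<noteq> p2 + e2\<^sup>2" and ne3: "p1 + e1\<^sup>2 \<noteq> p3 + e3\<^sup>2" and "e1 \<le> 0"
  shows "p2 = p3 \<and> l2 = l3 \<and> k2 = k3 \<or> p1 = p3 \<and> l1 = l3 \<and> k1 = k3"
proof -
  \<comment> \<open>Naming the squares and the shifted linear coefficients makes the comparison of
    keys linear.\<close>
  define s1 s2 s3 where "s1 = e1\<^sup>2" and "s2 = e2\<^sup>2" and "s3 = e3\<^sup>2"
  define m1 m2 m3 where "m1 = l1 - e1 * d1" and "m2 = l2 - e2 * d2" and "m3 = l3 - e3 * d3"
  have s: "s1 \<ge> 0" "s2 \<ge> 0" "s3 \<ge> 0" "e1 = 0 \<longleftrightarrow> s1 = 0" "e2 = 0 \<longleftrightarrow> s2 = 0" "e3 = 0 \<longleftrightarrow> s3 = 0"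
    by (auto simp: s1_def s2_def s3_def)
  \<comment> \<open>If the keys agree at both ends, the slopes and then the offsets coincide, so
    equal tail constants give equal \<open>k\<close>.\<close>
  have k: "k2 = k3" if "e2 < 0" "e3 < 0" "s2 = s3" "l2 = l3" "m2 = m3" "tail_const k2 e2 d2 = tail_const k3 e3 d3"
  proof -
    have "e2 = e3" using that(1-3) by (auto simp: s2_def s3_def power2_eq_iff)
    then show ?thesis using that by (simp add: m2_def m3_def tail_const_def)
  qed
  have key: "tail_key p1 l1 e1 d1 = (if e1 < 0 then (p1 + s1, m1, 1) else (p1, l1, 0))"
    "tail_key p2 l2 e2 d2 = (if e2 < 0 then (p2 + s2, m2, 1) else (p2, l2, 0))"
    "tail_key p3 l3 e3 d3 = (if e3 < 0 then (p3 + s3, m3, 1) else (p3, l3, 0))"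
    "tail_key p1 (- l1) (- e1) d1 = (if e1 > 0 then (p1 + s1, - m1, 1) else (p1, - l1, 0))"
    "tail_key p2 (- l2) (- e2) d2 = (if e2 > 0 then (p2 + s2, - m2, 1) else (p2, - l2, 0))"
    "tail_key p3 (- l3) (- e3) d3 = (if e3 > 0 then (p3 + s3, - m3, 1) else (p3, - l3, 0))"
    by (auto simp: tail_key_def s1_def s2_def s3_def m1_def m2_def m3_def)
  have const: "tail_const k e d = k" if "e \<ge> 0" for k e d
    using that by (simp add: tail_const_def)
  note top = skew_line_sum_tail[OF sum, unfolded key]
  note bot = skew_line_sum_tail[OF skew_line_sum_reflect[OF sum], unfolded key]
  note ne = ne2[folded s1_def s2_def] ne3[folded s1_def s3_def]
  have e1: "e1 < 0 \<or> e1 = 0" using \<open>e1 \<le> 0\<close> by linarith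
  consider "e2 < 0" "e3 < 0" | "e2 < 0" "e3 = 0" | "e2 < 0" "e3 > 0"
    | "e2 = 0" "e3 < 0" | "e2 = 0" "e3 = 0" | "e2 = 0" "e3 > 0"
    | "e2 > 0" "e3 < 0" | "e2 > 0" "e3 = 0" | "e2 > 0" "e3 > 0" by linarith
  then show ?thesis
    by cases (rule disjE[OF e1]; use k s ne top bot in \<open>force simp: const\<close>)+
qed

text \<open>Whichever summand shares its Gaussian with the right-hand side, the other one then has
  the same \<open>p + e^2\<close> as that summand, against \<open>ne2\<close>.\<close>

lemma skew_line_sum_impossible:
  assumes sum: "\<And>t. skew_line p1 l1 k1 e1 d1 t + skew_line p2 l2 k2 e2 d2 t = skew_line p3 l3 k3 e3 d3 t"
    and ne2: "p1 + e1\<^sup>2 \<noteq> p2 + e2\<^sup>2" and ne3: "p1 + e1\<^sup>2 \<noteq> p3 + e3\<^sup>2"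
  shows False
proof -
  have sum': "skew_line p2 l2 k2 e2 d2 t + skew_line p1 l1 k1 e1 d1 t = skew_line p3 l3 k3 e3 d3 t" for t
    using sum[of t] by simp
  have "p2 = p3 \<and> l2 = l3 \<and> k2 = k3 \<or> p1 = p3 \<and> l1 = l3 \<and> k1 = k3"
    using skew_line_sum_gauss_cases[OF sum ne2 ne3]
      skew_line_sum_gauss_cases[OF skew_line_sum_reflect[OF sum]] ne2 ne3
    by (cases "e1 \<le> 0") auto
  then show False
    using skew_line_sum_same_gauss[of p1 l1 k1 e1 d1 p2 l2 k2 e2 d2 e3 d3] sum
      skew_line_sum_same_gauss[of p2 l2 k2 e2 d2 p1 l1 k1 e1 d1 e3 d3] sum' ne2 ne3
    by auto
qed

section \<open>Symmetric matrices and square roots\<close>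

text \<open>The quadratic form attains its maximum on the compact unit sphere of the invariant
  subspace, and a maximiser is an eigenvector.\<close>

lemma selfadjoint_eigenvector_exists:
  fixes f :: "'a::euclidean_space \<Rightarrow> 'a"
  assumes lin: "linear f" and sym: "\<And>x y. f x \<bullet> y = x \<bullet> f y"
    and S: "subspace S" and inv: "\<And>x. x \<in> S \<Longrightarrow> f x \<in> S" and "y \<in> S" "y \<noteq> 0"
  obtains x c where "x \<in> S" "norm x = 1" "f x = c *\<^sub>R x"
proof -
  let ?K = "sphere 0 1 \<inter> S"
  have "compact ?K"
    by (intro compact_Int_closed closed_subspace S compact_sphere)
  moreover have "(1 / norm y) *\<^sub>R y \<in> ?K"
    using \<open>y \<in> S\<close> \<open>y \<noteq> 0\<close> by (auto intro!: subspace_scale S)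
  then have "?K \<noteq> {}" by blast
  moreover have "continuous_on ?K (\<lambda>x. x \<bullet> f x)"
    by (intro continuous_intros linear_continuous_on_compose[OF continuous_on_id lin])
  ultimately obtain x where x: "x \<in> ?K" and max: "\<And>z. z \<in> ?K \<Longrightarrow> z \<bullet> f z \<le> x \<bullet> f x"
    using continuous_attains_sup[of ?K "\<lambda>x. x \<bullet> f x"] by blast
  define c where "c = x \<bullet> f x"
  have xx: "x \<bullet> x = 1" using x by (simp add: norm_eq_1)
  have le: "z \<bullet> f z \<le> c * (z \<bullet> z)" if "z \<in> S" for z
  proof (cases "z = 0")
    case True
    then show ?thesis by simp
  next
    case False
    have "(1 / norm z) *\<^sub>R z \<in> ?K"
      using that False by (auto intro!: subspace_scale S)
    from max[OF this] have "(z \<bullet> f z) / (norm z)\<^sup>2 \<le> c"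
      by (simp add: linear_scale[OF lin] c_def power2_eq_square)
    then show ?thesis
      using False by (simp add: divide_le_eq power2_norm_eq_inner)
  qed
  \<comment> \<open>The defect of the eigenvector equation. Moving from \<open>x\<close> to
    \<open>x + t * h\<close> with small negative \<open>t\<close> would violate the maximality bound
    \<open>le\<close> unless \<open>h = 0\<close>.\<close>
  define h where "h = c *\<^sub>R x - f x"
  have "h \<in> S"
    unfolding h_def using x by (auto intro!: subspace_diff subspace_scale S inv)
  define u where "u = c * (h \<bullet> h) - h \<bullet> f h"
  have poly: "0 \<le> 2 * t * (h \<bullet> h) + t\<^sup>2 * u" for t
  proof -
    have "x + t *\<^sub>R h \<in> S"
      using x \<open>h \<in> S\<close> by (auto intro!: subspace_add subspace_scale S)
    from le[OF this]
    have "(x \<bullet> f x + t * (x \<bullet> f h) + t * (h \<bullet> f x) + t\<^sup>2 * (h \<bullet> f h)) \<le> c * (x \<bullet> x + 2 * t * (x \<bullet> h) + t\<^sup>2 * (h \<bullet> h))"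
      by (simp add: linear_add[OF lin] linear_scale[OF lin] inner_add power2_eq_square algebra_simps inner_commute)
    moreover have hf: "h \<bullet> f x = c * (x \<bullet> h) - h \<bullet> h"
      by (subst (3) h_def) (simp add: inner_diff inner_commute)
    moreover have "x \<bullet> f h = c * (x \<bullet> h) - h \<bullet> h"
      using hf by (metis sym inner_commute)
    ultimately show ?thesis
      by (simp add: u_def xx c_def[symmetric] algebra_simps)
  qed
  have "h \<bullet> h = 0"
  proof (rule ccontr)
    assume "h \<bullet> h \<noteq> 0"
    then have pos: "h \<bullet> h > 0" using inner_ge_zero[of h] by linarith
    define t where "t = - (h \<bullet> h) / (\<bar>u\<bar> + 1)"
    have t: "t < 0" using pos by (simp add: t_def divide_neg_pos)
    have "\<bar>t\<bar> * \<bar>u\<bar> \<le> h \<bullet> h"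
      using pos by (simp add: t_def abs_div_pos divide_le_eq field_simps)
    then have "- (t * u) \<le> h \<bullet> h"
      by (metis abs_ge_minus_self abs_mult order_trans)
    then have "0 < 2 * (h \<bullet> h) + t * u" using pos by linarith
    then have "t * (2 * (h \<bullet> h) + t * u) < 0" using t by (simp add: mult_neg_pos)
    then show False using poly[of t] by (simp add: algebra_simps power2_eq_square)
  qed
  then have "f x = c *\<^sub>R x" by (simp add: h_def)
  then show ?thesis using that x by auto
qed

text \<open>Orthonormal eigenvectors are collected one at a time: the orthogonal complement of those
  already found is invariant and, below full dimension, nonzero.\<close>

lemma selfadjoint_eigenbasis_exists:
  fixes f :: "'a::euclidean_space \<Rightarrow> 'a"
  assumes lin: "linear f" and sym: "\<And>x y. f x \<bullet> y = x \<bullet> f y"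
  obtains B ev where "finite B" "pairwise orthogonal B" "\<And>b. b \<in> B \<Longrightarrow> norm b = 1" "span B = UNIV"
    "\<And>b. b \<in> B \<Longrightarrow> f b = ev b *\<^sub>R b"
proof -
  have "\<exists>B. finite B \<and> card B = n \<and> pairwise orthogonal B \<and> (\<forall>b\<in>B. norm b = 1 \<and> (\<exists>c. f b = c *\<^sub>R b))"
    if "n \<le> DIM('a)" for n
    using that
  proof (induction n)
    case 0
    then show ?case by (intro exI[of _ "{}"]) simp
  next
    case (Suc n)
    then obtain B where B: "finite B" "card B = n" "pairwise orthogonal B"
      "\<And>b. b \<in> B \<Longrightarrow> norm b = 1" and ev: "\<And>b. b \<in> B \<Longrightarrow> \<exists>c. f b = c *\<^sub>R b"
      by auto
    have "dim B < DIM('a)"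
      using dim_le_card'[OF \<open>finite B\<close>] B(2) Suc.prems by linarith
    then obtain y where y: "y \<noteq> 0" "\<And>b. b \<in> span B \<Longrightarrow> orthogonal y b"
      using orthogonal_to_subspace_exists by metis
    define S where "S = {x. \<forall>b\<in>B. x \<bullet> b = 0}"
    have "subspace S" by (auto simp: S_def subspace_def inner_add_left)
    moreover have "f x \<in> S" if "x \<in> S" for x
    proof -
      have "f x \<bullet> b = 0" if "b \<in> B" for b
      proof -
        obtain c where "f b = c *\<^sub>R b" using ev[OF \<open>b \<in> B\<close>] by blast
        then show ?thesis using \<open>x \<in> S\<close> \<open>b \<in> B\<close> by (simp add: sym S_def)
      qed
      then show ?thesis by (simp add: S_def)
    qed
    moreover have "y \<in> S"
      using y(2) by (auto simp: S_def orthogonal_def span_base)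
    ultimately obtain x c where x: "x \<in> S" "norm x = 1" "f x = c *\<^sub>R x"
      using selfadjoint_eigenvector_exists[OF lin sym _ _ _ y(1)] by metis
    have "x \<notin> B"
    proof
      assume "x \<in> B"
      then have "x \<bullet> x = 0" using x(1) by (simp add: S_def)
      then show False using x(2) by simp
    qed
    moreover have "pairwise orthogonal (insert x B)"
      using B(3) x(1) by (auto simp: pairwise_insert S_def orthogonal_def inner_commute)
    ultimately show ?case
      using B ev x by (intro exI[of _ "insert x B"]) auto
  qed
  from this[OF order_refl] obtain B where B: "finite B" "card B = DIM('a)" "pairwise orthogonal B"
      "\<And>b. b \<in> B \<Longrightarrow> norm b = 1" and ev: "\<forall>b\<in>B. \<exists>c. f b = c *\<^sub>R b"
    by auto
  have "0 \<notin> B" using B(4) by force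
  then have "independent B"
    using B(3) pairwise_orthogonal_independent by blast
  then have "span B = UNIV"
    using B(2) by (metis card_ge_dim_independent dim_UNIV order_refl subset_UNIV top.extremum_uniqueI)
  then show ?thesis
    using that B bchoice[OF ev] by metis
qed

section \<open>Positive definite matrices and their roots\<close>

lemma transpose_eq_iff_selfadjoint:
  fixes A :: "real^'n^'n"
  shows "transpose A = A \<longleftrightarrow> (\<forall>x y. (A *v x) \<bullet> y = x \<bullet> (A *v y))"
proof
  assume "transpose A = A"
  then show "\<forall>x y. (A *v x) \<bullet> y = x \<bullet> (A *v y)"
    by (metis dot_lmul_matrix transpose_matrix_vector)
next
  assume *: "\<forall>x y. (A *v x) \<bullet> y = x \<bullet> (A *v y)"
  have "transpose A *v x = A *v x" for x
    by (rule vector_eq_ldot[THEN iffD1])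
       (metis * dot_lmul_matrix inner_commute transpose_matrix_vector)
  then show "transpose A = A" by (simp add: matrix_eq)
qed

lemma spd_selfadjoint: "spd A \<Longrightarrow> (A *v x) \<bullet> y = x \<bullet> (A *v y)"
  using transpose_eq_iff_selfadjoint unfolding spd_def by blast

lemma spd_sqrt_exists:
  assumes "spd (A :: real^'n^'n)"
  shows "\<exists>S. spd S \<and> S ** S = A"
proof -
  obtain B ev where B: "finite B" "pairwise orthogonal B" "\<And>b. b \<in> B \<Longrightarrow> norm b = 1" "span B = UNIV"
    and ev: "\<And>b. b \<in> B \<Longrightarrow> A *v b = ev b *\<^sub>R b"
    using selfadjoint_eigenbasis_exists[OF matrix_vector_mul_linear, of A] spd_selfadjoint[OF assms] by metis
  have pos: "ev b > 0" if "b \<in> B" for b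
  proof -
    have "b \<noteq> 0" using B(3)[OF that] by auto
    then have "0 < b \<bullet> (A *v b)" using assms by (simp add: spd_def)
    then show ?thesis using ev[OF that] B(3)[OF that] by (simp add: norm_eq_1)
  qed
  \<comment> \<open>The operator that is diagonal in the eigenbasis, with the square roots of the
    eigenvalues.\<close>
  define g where "g = (\<lambda>x. \<Sum>b\<in>B. (sqrt (ev b) * (b \<bullet> x)) *\<^sub>R b)"
  have lin: "linear g"
    by (rule linearI) (simp_all add: g_def inner_add_right distrib_left scaleR_add_left sum.distrib
        scaleR_sum_right mult.left_commute)
  define S where "S = matrix g"
  have S: "S *v x = g x" for x
    using matrix_vector_mul(2)[OF lin] by (metis S_def)
  have gb: "g b = sqrt (ev b) *\<^sub>R b" if "b \<in> B" for b
  proof -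
    have "g b = (\<Sum>b'\<in>B. if b' = b then sqrt (ev b) *\<^sub>R b else 0)"
      unfolding g_def
    proof (rule sum.cong)
      fix b' assume "b' \<in> B"
      then show "(sqrt (ev b') * (b' \<bullet> b)) *\<^sub>R b' = (if b' = b then sqrt (ev b) *\<^sub>R b else 0)"
        using that B(2) B(3)[OF that] by (auto simp: norm_eq_1 pairwise_def orthogonal_def)
    qed simp
    then show ?thesis using that B(1) by simp
  qed
  have dot: "x \<bullet> g y = (\<Sum>b\<in>B. sqrt (ev b) * (b \<bullet> x) * (b \<bullet> y))" for x y
    by (simp add: g_def inner_sum_right inner_commute mult_ac)
  have "S ** S = A"
  proof -
    have "(S ** S) *v x = A *v x" for x
    proof (rule linear_eq_on[OF matrix_vector_mul_linear matrix_vector_mul_linear])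
      show "x \<in> span B" by (simp add: B(4))
      fix b assume "b \<in> B"
      then have "0 \<le> ev b" using pos by (simp add: less_imp_le)
      then show "(S ** S) *v b = A *v b"
        using \<open>b \<in> B\<close> by (simp add: gb S ev linear_scale[OF lin] flip: matrix_vector_mul_assoc)
    qed
    then show ?thesis by (simp add: matrix_eq)
  qed
  moreover have "spd S"
    unfolding spd_def transpose_eq_iff_selfadjoint
  proof (intro conjI allI impI)
    fix x y
    show "(S *v x) \<bullet> y = x \<bullet> (S *v y)"
      by (subst inner_commute) (simp add: S dot mult_ac)
  next
    fix x :: "real^'n" assume "x \<noteq> 0"
    have "\<exists>b\<in>B. b \<bullet> x \<noteq> 0"
    proof (rule ccontr)
      assume "\<not> ?thesis"
      then have "orthogonal x b" if "b \<in> B" for b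
        using that by (simp add: orthogonal_def inner_commute)
      then have "orthogonal x x"
        using orthogonal_to_span[of x B x] B(4) by auto
      then show False using \<open>x \<noteq> 0\<close> by (simp add: orthogonal_def)
    qed
    then obtain b where b: "b \<in> B" "b \<bullet> x \<noteq> 0" by blast
    show "0 < x \<bullet> (S *v x)"
      unfolding S dot
    proof (rule sum_pos2[OF B(1) b(1)])
      show "0 < sqrt (ev b) * (b \<bullet> x) * (b \<bullet> x)"
        using pos[OF b(1)] b(2) by (auto simp: mult.assoc zero_less_mult_iff)
      show "0 \<le> sqrt (ev b') * (b' \<bullet> x) * (b' \<bullet> x)" if "b' \<in> B" for b'
        using pos[OF that] by (simp add: mult.assoc)
    qed
  qed
  ultimately show ?thesis by blast
qed

text \<open>Equality of the squares reads \<open>S ** D + D ** T = 0\<close> for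
  \<open>D = S - T\<close>. Pairing with an eigenvector of \<open>D\<close> on both sides gives its
  eigenvalue times a positive number, so all eigenvalues of \<open>D\<close> vanish.\<close>

lemma spd_sqrt_unique:
  assumes "spd (S :: real^'n^'n)" "spd T" and eq: "S ** S = T ** T"
  shows "S = T"
proof -
  define D where "D = S - T"
  have sym: "(D *v x) \<bullet> y = x \<bullet> (D *v y)" for x y
    using assms(1,2) by (simp add: D_def matrix_vector_mult_diff_rdistrib inner_diff spd_selfadjoint)
  obtain B ev where B: "\<And>b. b \<in> B \<Longrightarrow> norm b = 1" "span B = UNIV"
    and ev: "\<And>b. b \<in> B \<Longrightarrow> D *v b = ev b *\<^sub>R b"
    using selfadjoint_eigenbasis_exists[OF matrix_vector_mul_linear, of D] sym by metis
  have "D *v b = 0" if "b \<in> B" for b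
  proof -
    have "b \<noteq> 0" using B(1)[OF that] by auto
    then have pos: "0 < b \<bullet> (S *v b) + b \<bullet> (T *v b)"
      using assms(1,2) by (simp add: spd_def add_pos_pos)
    have "S *v (S *v b) = T *v (T *v b)"
      by (simp add: matrix_vector_mul_assoc eq)
    then have "S *v (D *v b) + D *v (T *v b) = 0"
      by (simp add: D_def matrix_vector_mult_diff_rdistrib matrix_vector_mult_diff_distrib)
    then have "0 = b \<bullet> (S *v (D *v b)) + b \<bullet> (D *v (T *v b))"
      by (metis inner_add_right inner_zero_right)
    also have "\<dots> = ev b * (b \<bullet> (S *v b) + b \<bullet> (T *v b))"
      unfolding sym[symmetric] by (simp add: ev[OF that] matrix_vector_mult_scaleR distrib_left)
    finally have "ev b = 0" using pos by simp
    then show ?thesis using ev[OF that] by simp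
  qed
  then have "D *v x = 0 *v x" for x
    using linear_eq_on[OF matrix_vector_mul_linear matrix_vector_mul_linear, of x B D 0] B(2) by simp
  then have "D = 0" using matrix_eq by blast
  then show ?thesis by (simp add: D_def)
qed

lemma spd_sqrt:
  assumes "spd A"
  shows "spd (spd_sqrt A)" "spd_sqrt A ** spd_sqrt A = A"
proof -
  have "\<exists>!S. spd S \<and> S ** S = A"
    using spd_sqrt_exists[OF assms] spd_sqrt_unique by metis
  from theI'[OF this] show "spd (spd_sqrt A)" "spd_sqrt A ** spd_sqrt A = A"
    by (auto simp: spd_sqrt_def)
qed

lemma spd_matrix_inv:
  assumes "spd (A :: real^'n^'n)"
  shows "A ** matrix_inv A = mat 1" "matrix_inv A ** A = mat 1"
proof -
  have "x = 0" if "A *v x = 0" for x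
    using assms that unfolding spd_def by (metis inner_zero_right less_irrefl)
  then have "invertible A"
    by (simp add: invertible_left_inverse matrix_left_invertible_ker)
  then have "A ** matrix_inv A = mat 1 \<and> matrix_inv A ** A = mat 1"
    unfolding matrix_inv_def invertible_def by (rule someI_ex)
  then show "A ** matrix_inv A = mat 1" "matrix_inv A ** A = mat 1" by auto
qed

section \<open>Multivariate skew normal densities\<close>

lemma spd_matrix_inv_selfadjoint:
  assumes "spd (A :: real^'n^'n)"
  shows "(matrix_inv A *v x) \<bullet> y = x \<bullet> (matrix_inv A *v y)"
proof -
  have inv: "A *v (matrix_inv A *v z) = z" for z
    by (simp add: matrix_vector_mul_assoc spd_matrix_inv[OF assms])
  show ?thesis
    using spd_selfadjoint[OF assms, of "matrix_inv A *v x" "matrix_inv A *v y"] by (simp add: inv)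
qed

lemma spd_det_pos:
  assumes "spd (A :: real^'n^'n)"
  shows "det A > 0"
proof -
  let ?S = "spd_sqrt A"
  have "invertible ?S"
    unfolding invertible_def using spd_matrix_inv[OF spd_sqrt(1)[OF assms]] by blast
  then have "det ?S \<noteq> 0" by (simp add: invertible_det_nz)
  moreover have "det A = det ?S * det ?S"
    using spd_sqrt(2)[OF assms] by (metis det_mul)
  ultimately show ?thesis
    by (auto simp: zero_less_mult_iff)
qed

section \<open>Quadratic forms and generic directions\<close>

lemma outer_product_vector_mult:
  fixes a b x :: "real^'n"
  shows "(\<chi> i j. a $ i * b $ j) *v x = (b \<bullet> x) *\<^sub>R a"
  by (simp add: vec_eq_iff matrix_vector_mult_def inner_vec_def sum_distrib_left mult_ac)

text \<open>By polarisation a symmetric matrix is determined by its quadratic form.\<close>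

lemma quadratic_form_neq:
  fixes M N :: "real^'n^'n"
  assumes "transpose M = M" "transpose N = N" "M \<noteq> N"
  obtains v where "v \<bullet> (M *v v) \<noteq> v \<bullet> (N *v v)"
proof -
  have "M = N" if eq: "\<And>v. v \<bullet> (M *v v) = v \<bullet> (N *v v)"
  proof -
    have sym: "y \<bullet> (M *v x) = x \<bullet> (M *v y)" "y \<bullet> (N *v x) = x \<bullet> (N *v y)" for x y
      using assms(1,2) by (metis transpose_eq_iff_selfadjoint inner_commute)+
    have "x \<bullet> (M *v y) = x \<bullet> (N *v y)" for x y
      using eq[of "x + y"] eq[of x] eq[of y]
      by (simp add: matrix_vector_right_distrib inner_add sym[of y x])
    then have "M *v y = N *v y" for y
      using vector_eq_ldot by blast
    then show ?thesis using matrix_eq by blast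
  qed
  then show ?thesis using that assms(3) by blast
qed

lemma quadratic_forms_neq_simultaneously:
  fixes M N1 N2 :: "real^'n^'n"
  assumes sym: "transpose M = M" "transpose N1 = N1" "transpose N2 = N2" and "M \<noteq> N1" "M \<noteq> N2"
  obtains v where "v \<bullet> (M *v v) \<noteq> v \<bullet> (N1 *v v)" "v \<bullet> (M *v v) \<noteq> v \<bullet> (N2 *v v)"
proof -
  obtain u where u: "u \<bullet> (M *v u) \<noteq> u \<bullet> (N1 *v u)"
    using quadratic_form_neq assms by metis
  obtain w where w: "w \<bullet> (M *v w) \<noteq> w \<bullet> (N2 *v w)"
    using quadratic_form_neq assms by metis
  \<comment> \<open>Along \<open>u + t * w\<close> each difference of forms is a quadratic
    polynomial in \<open>t\<close>. The first has a nonzero constant coefficient by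
    \<open>u\<close>, the second a nonzero leading one by \<open>w\<close>, so some \<open>t\<close>
    avoids the roots of both.\<close>
  define q where "q = (\<lambda>D::real^'n^'n. [: u \<bullet> (D *v u), u \<bullet> (D *v w) + w \<bullet> (D *v u), w \<bullet> (D *v w) :])"
  have q: "poly (q D) t = (u + t *\<^sub>R w) \<bullet> (D *v (u + t *\<^sub>R w))" for D t
    by (simp add: q_def matrix_vector_right_distrib matrix_vector_mult_scaleR inner_add algebra_simps)
  have "q (M - N1) \<noteq> 0" "q (M - N2) \<noteq> 0"
    using u w by (auto simp: q_def matrix_vector_mult_diff_rdistrib inner_diff)
  then have "q (M - N1) * q (M - N2) \<noteq> 0" by simp
  then have "finite {t. poly (q (M - N1) * q (M - N2)) t = 0}"
    by (rule poly_roots_finite)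
  then have "{t. poly (q (M - N1) * q (M - N2)) t = 0} \<noteq> UNIV"
    using infinite_UNIV_char_0 by metis
  then obtain t where "poly (q (M - N1) * q (M - N2)) t \<noteq> 0"
    by blast
  then show ?thesis
    by (intro that[of "u + t *\<^sub>R w"]) (auto simp: q matrix_vector_mult_diff_rdistrib inner_diff_right)
qed

section \<open>The inverse of \<Gamma>\<close>

definition msn_slant :: "real^'n^'n \<Rightarrow> real^'n \<Rightarrow> real^'n" where
  "msn_slant \<Omega> \<Lambda> = matrix_inv (spd_sqrt \<Omega>) *v \<Lambda>"

definition msn_precision :: "real^'n^'n \<Rightarrow> real^'n \<Rightarrow> real^'n^'n" where
  "msn_precision \<Omega> \<Lambda> = matrix_inv \<Omega> + (\<chi> i j. msn_slant \<Omega> \<Lambda> $ i * msn_slant \<Omega> \<Lambda> $ j)"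

lemma msn_precision_vector_mult:
  "msn_precision \<Omega> \<Lambda> *v x = matrix_inv \<Omega> *v x + (msn_slant \<Omega> \<Lambda> \<bullet> x) *\<^sub>R msn_slant \<Omega> \<Lambda>"
  by (simp add: msn_precision_def matrix_vector_mult_add_rdistrib outer_product_vector_mult)

lemma msn_precision_symmetric:
  assumes "spd \<Omega>"
  shows "transpose (msn_precision \<Omega> \<Lambda>) = msn_precision \<Omega> \<Lambda>"
  unfolding transpose_eq_iff_selfadjoint
  by (simp add: msn_precision_vector_mult inner_add spd_matrix_inv_selfadjoint[OF assms])
     (simp add: inner_commute)

lemma msn_precision_quadratic_form:
  "v \<bullet> (msn_precision \<Omega> \<Lambda> *v v) = v \<bullet> (matrix_inv \<Omega> *v v) + (msn_slant \<Omega> \<Lambda> \<bullet> v)\<^sup>2"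
  by (simp add: msn_precision_vector_mult inner_add_right inner_commute power2_eq_square)

text \<open>A Sherman-Morrison computation: \<Delta> is \<open>\<alpha>\<close> times
  \<open>\<Omega> *v \<eta>\<close>, so both matrices are rank-one updates along matching vectors,
  and \<open>\<alpha>^2 * (1 + \<Lambda> \<bullet> \<Lambda>) = 1\<close> cancels the terms in
  \<open>\<eta>\<close>.\<close>

lemma msn_precision_Gamma:
  assumes "spd \<Omega>"
  shows "msn_precision \<Omega> \<Lambda> ** msn_Gamma \<Omega> \<Lambda> = mat 1"
proof -
  define S where "S = spd_sqrt \<Omega>"
  define \<eta> where "\<eta> = msn_slant \<Omega> \<Lambda>"
  define \<alpha> where "\<alpha> = 1 / sqrt (1 + \<Lambda> \<bullet> \<Lambda>)"
  have S: "spd S" "S ** S = \<Omega>" using spd_sqrt[OF assms] by (auto simp: S_def)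
  have S\<eta>: "S *v \<eta> = \<Lambda>"
    by (simp add: \<eta>_def msn_slant_def S_def[symmetric] matrix_vector_mul_assoc spd_matrix_inv[OF S(1)])
  have \<Omega>\<eta>: "\<Omega> *v \<eta> = S *v \<Lambda>"
    by (metis S(2) S\<eta> matrix_vector_mul_assoc)
  have \<Delta>: "msn_Delta \<Omega> \<Lambda> = \<alpha> *\<^sub>R (\<Omega> *v \<eta>)"
    by (simp add: msn_Delta_def msn_delta_def S_def[symmetric] \<alpha>_def[symmetric]
        matrix_vector_mult_scaleR \<Omega>\<eta>)
  have \<eta>\<Omega>\<eta>: "\<eta> \<bullet> (\<Omega> *v \<eta>) = \<Lambda> \<bullet> \<Lambda>"
    by (simp add: S(2)[symmetric] S\<eta> flip: matrix_vector_mul_assoc spd_selfadjoint[OF S(1)])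
  have "1 + \<Lambda> \<bullet> \<Lambda> > 0" using inner_ge_zero[of \<Lambda>] by linarith
  then have \<alpha>: "\<alpha> * \<alpha> * (1 + \<Lambda> \<bullet> \<Lambda>) = 1"
    by (simp add: \<alpha>_def)
  have inv: "matrix_inv \<Omega> *v (\<Omega> *v x) = x" for x
    by (simp add: matrix_vector_mul_assoc spd_matrix_inv[OF assms])
  have "msn_precision \<Omega> \<Lambda> *v (msn_Gamma \<Omega> \<Lambda> *v x) = x" for x
  proof -
    define z where "z = (\<Omega> *v \<eta>) \<bullet> x"
    have z: "\<eta> \<bullet> (\<Omega> *v x) = z" by (simp add: z_def spd_selfadjoint[OF assms])
    have "msn_Gamma \<Omega> \<Lambda> *v x = \<Omega> *v x - (\<alpha> * \<alpha> * z) *\<^sub>R (\<Omega> *v \<eta>)"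
      unfolding msn_Gamma_def matrix_vector_mult_diff_rdistrib outer_product_vector_mult
      by (simp add: \<Delta> z_def)
    then have "msn_precision \<Omega> \<Lambda> *v (msn_Gamma \<Omega> \<Lambda> *v x)
        = x - (\<alpha> * \<alpha> * z) *\<^sub>R \<eta> + (z - \<alpha> * \<alpha> * z * (\<Lambda> \<bullet> \<Lambda>)) *\<^sub>R \<eta>"
      by (simp add: msn_precision_vector_mult \<eta>_def[symmetric] matrix_vector_mult_diff_distrib
          matrix_vector_mult_scaleR inv inner_diff_right z \<eta>\<Omega>\<eta> scaleR_diff_left scaleR_add_right)
    also have "\<dots> = x + (z - \<alpha> * \<alpha> * (1 + \<Lambda> \<bullet> \<Lambda>) * z) *\<^sub>R \<eta>"
      by (simp add: algebra_simps)
    finally show ?thesis by (simp add: \<alpha>)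
  qed
  then show ?thesis by (simp add: matrix_eq matrix_vector_mul_assoc)
qed

lemma msn_Gamma_neq_imp_precision_neq:
  assumes "spd \<Omega>" "spd \<Omega>'" "msn_Gamma \<Omega> \<Lambda> \<noteq> msn_Gamma \<Omega>' \<Lambda>'"
  shows "msn_precision \<Omega> \<Lambda> \<noteq> msn_precision \<Omega>' \<Lambda>'"
proof
  let ?Q = "msn_precision \<Omega> \<Lambda>"
  assume eq: "?Q = msn_precision \<Omega>' \<Lambda>'"
  have 1: "?Q ** msn_Gamma \<Omega> \<Lambda> = mat 1" and 2: "?Q ** msn_Gamma \<Omega>' \<Lambda>' = mat 1"
    using msn_precision_Gamma assms(1,2) eq by metis+
  have "msn_Gamma \<Omega> \<Lambda> = msn_Gamma \<Omega> \<Lambda> ** (?Q ** msn_Gamma \<Omega>' \<Lambda>')"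
    by (simp add: 2)
  also have "\<dots> = msn_Gamma \<Omega>' \<Lambda>'"
    using 1 by (simp add: matrix_mul_assoc matrix_left_right_inverse)
  finally show False using assms(3) by simp
qed

section \<open>Restriction to a line, and identifiability\<close>

lemma msn_density_on_line:
  fixes \<mu> \<Lambda> v :: "real^'n"
  assumes spd: "spd \<Omega>" and "c > 0"
  shows "\<exists>l k d. \<forall>t. c * msn_density \<mu> \<Omega> \<Lambda> (t *\<^sub>R v) =
    skew_line (v \<bullet> (matrix_inv \<Omega> *v v)) l k (msn_slant \<Omega> \<Lambda> \<bullet> v) d t"
proof -
  define P where "P = matrix_inv \<Omega>"
  define \<eta> where "\<eta> = msn_slant \<Omega> \<Lambda>"
  define C where "C = 2 * c / sqrt ((2 * pi) ^ CARD('n) * det \<Omega>)"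
  have "C > 0"
    using spd_det_pos[OF spd] \<open>c > 0\<close> by (simp add: C_def)
  \<comment> \<open>The line runs through the origin, so one line serves densities with different
    \<open>\<mu>\<close>. The location enters only \<open>l\<close>, \<open>k\<close> and
    \<open>d\<close>, whereas \<open>p + e^2\<close> is the quadratic form of
    \<open>msn_precision\<close> at \<open>v\<close>.\<close>
  define p l d e where "p = v \<bullet> (P *v v)" and "l = v \<bullet> (P *v \<mu>)" and "d = - (\<eta> \<bullet> \<mu>)" and "e = \<eta> \<bullet> v"
  define k where "k = ln C - \<mu> \<bullet> (P *v \<mu>) / 2"
  have sym: "\<mu> \<bullet> (P *v v) = l"
    using spd_matrix_inv_selfadjoint[OF spd, of \<mu> v] by (simp add: l_def P_def inner_commute)
  have "c * msn_density \<mu> \<Omega> \<Lambda> (t *\<^sub>R v) = exp (- p / 2 * t\<^sup>2 + l * t + k) * std_normal_cdf (e * t + d)" for t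
  proof -
    let ?y = "t *\<^sub>R v - \<mu>"
    have "?y \<bullet> (P *v ?y) = p * t\<^sup>2 - 2 * (l * t) + \<mu> \<bullet> (P *v \<mu>)"
      by (simp add: matrix_vector_mult_diff_distrib matrix_vector_mult_scaleR inner_diff
          sym l_def[symmetric] p_def[symmetric] power2_eq_square algebra_simps)
    then have "- p / 2 * t\<^sup>2 + l * t + k = ln C + - (?y \<bullet> (P *v ?y)) / 2"
      by (simp add: k_def field_simps)
    then have expo: "exp (- p / 2 * t\<^sup>2 + l * t + k) = C * exp (- (?y \<bullet> (P *v ?y)) / 2)"
      using \<open>C > 0\<close> by (simp only: exp_add exp_ln)
    have "\<Lambda> \<bullet> (matrix_inv (spd_sqrt \<Omega>) *v ?y) = \<eta> \<bullet> ?y"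
      by (simp add: \<eta>_def msn_slant_def spd_matrix_inv_selfadjoint[OF spd_sqrt(1)[OF spd]])
    also have "\<dots> = e * t + d"
      by (simp add: e_def d_def inner_diff_right)
    finally show ?thesis
      unfolding msn_density_def mvn_density_def expo by (simp add: C_def P_def)
  qed
  moreover have "exp (- p / 2 * t\<^sup>2 + l * t + k) * std_normal_cdf (e * t + d)
      = skew_line p l (if e = 0 then k + ln (std_normal_cdf d) else k) e d t" for t
    using std_normal_cdf_pos[of d] by (simp add: skew_line_def exp_add)
  ultimately show ?thesis
    unfolding p_def e_def P_def \<eta>_def by metis
qed

text \<open>Different \<Gamma> have different inverses, so some direction separates the first
  quadratic form from both others; along it the equation becomes an impossible sum of skew
  lines.\<close>

lemma msn_combination_neq:
  fixes \<mu>1 \<mu>2 \<mu>3 \<Lambda>1 \<Lambda>2 \<Lambda>3 :: "real^'n"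
  assumes spd: "spd \<Omega>1" "spd \<Omega>2" "spd \<Omega>3" and c: "c1 > 0" "c2 > 0" "c3 > 0"
    and \<Gamma>: "msn_Gamma \<Omega>2 \<Lambda>2 \<noteq> msn_Gamma \<Omega>1 \<Lambda>1" "msn_Gamma \<Omega>3 \<Lambda>3 \<noteq> msn_Gamma \<Omega>1 \<Lambda>1"
  shows "\<exists>x. c1 * msn_density \<mu>1 \<Omega>1 \<Lambda>1 x + c2 * msn_density \<mu>2 \<Omega>2 \<Lambda>2 x \<noteq> c3 * msn_density \<mu>3 \<Omega>3 \<Lambda>3 x"
proof (rule ccontr)
  assume "\<not> ?thesis"
  then have eq: "c1 * msn_density \<mu>1 \<Omega>1 \<Lambda>1 x + c2 * msn_density \<mu>2 \<Omega>2 \<Lambda>2 x = c3 * msn_density \<mu>3 \<Omega>3 \<Lambda>3 x" for x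
    by blast
  obtain v where v: "v \<bullet> (msn_precision \<Omega>1 \<Lambda>1 *v v) \<noteq> v \<bullet> (msn_precision \<Omega>2 \<Lambda>2 *v v)"
      "v \<bullet> (msn_precision \<Omega>1 \<Lambda>1 *v v) \<noteq> v \<bullet> (msn_precision \<Omega>3 \<Lambda>3 *v v)"
    using quadratic_forms_neq_simultaneously msn_precision_symmetric spd
      msn_Gamma_neq_imp_precision_neq[OF spd(1,2) \<Gamma>(1)[symmetric]]
      msn_Gamma_neq_imp_precision_neq[OF spd(1,3) \<Gamma>(2)[symmetric]] by metis
  show False
    using msn_density_on_line[OF spd(1) c(1), of \<mu>1 \<Lambda>1 v] msn_density_on_line[OF spd(2) c(2), of \<mu>2 \<Lambda>2 v]
      msn_density_on_line[OF spd(3) c(3), of \<mu>3 \<Lambda>3 v]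
      skew_line_sum_impossible v eq[of "_ *\<^sub>R v"]
    unfolding msn_precision_quadratic_form by metis
qed

theorem theorem2:
  fixes \<mu>1 \<Lambda>1 :: "real^'n" and \<Omega>1 :: "real^'n^'n"
  assumes "spd \<Omega>1"
  shows "identifiable
    {msn_density \<mu> \<Omega> \<Lambda> | \<mu> \<Omega> \<Lambda>. spd \<Omega> \<and> msn_Gamma \<Omega> \<Lambda> \<noteq> msn_Gamma \<Omega>1 \<Lambda>1}
    (msn_density \<mu>1 \<Omega>1 \<Lambda>1)"
proof -
  let ?f1 = "msn_density \<mu>1 \<Omega>1 \<Lambda>1"
  let ?P = "{msn_density \<mu> \<Omega> \<Lambda> | \<mu> \<Omega> \<Lambda>. spd \<Omega> \<and> msn_Gamma \<Omega> \<Lambda> \<noteq> msn_Gamma \<Omega>1 \<Lambda>1}"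
  \<comment> \<open>For \<open>b < a\<close>, moving the term \<open>b * f1\<close> to the left
    leaves an identity with three positive coefficients. Exchanging the roles of the two mixtures
    excludes \<open>a < b\<close>.\<close>
  have not_less: "\<not> b < a" if a: "a < 1" and h: "h \<in> ?P" and g: "g \<in> ?P"
    and eq: "mixture ?f1 a h = mixture ?f1 b g" for a b h g
  proof
    assume "b < a"
    obtain \<mu>2 \<Omega>2 \<Lambda>2 where h: "h = msn_density \<mu>2 \<Omega>2 \<Lambda>2" "spd \<Omega>2" "msn_Gamma \<Omega>2 \<Lambda>2 \<noteq> msn_Gamma \<Omega>1 \<Lambda>1"
      using h by blast
    obtain \<mu>3 \<Omega>3 \<Lambda>3 where g: "g = msn_density \<mu>3 \<Omega>3 \<Lambda>3" "spd \<Omega>3" "msn_Gamma \<Omega>3 \<Lambda>3 \<noteq> msn_Gamma \<Omega>1 \<Lambda>1"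
      using g by blast
    have comb: "(a - b) * ?f1 x + (1 - a) * h x = (1 - b) * g x" for x
      using fun_cong[OF eq, of x] by (simp add: mixture_def algebra_simps)
    have "\<exists>x. (a - b) * ?f1 x + (1 - a) * h x \<noteq> (1 - b) * g x"
      unfolding h(1) g(1) by (rule msn_combination_neq[OF assms h(2) g(2) _ _ _ h(3) g(3)]) (use \<open>b < a\<close> a in auto)
    then show False using comb by blast
  qed
  show ?thesis
    unfolding identifiable_def
  proof (intro ballI impI)
    fix a b :: real and h g
    assume ab: "a \<in> {0<..<1}" "b \<in> {0<..<1}" and hg: "h \<in> ?P" "g \<in> ?P"
      and eq: "mixture ?f1 a h = mixture ?f1 b g"
    have "a = b"
      using not_less[OF _ hg eq] not_less[OF _ hg(2,1) eq[symmetric]] ab by auto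
    moreover have "h x = g x" for x
      using fun_cong[OF eq, of x] ab \<open>a = b\<close> by (simp add: mixture_def)
    ultimately show "(a, h) = (b, g)" by auto
  qed
qed

end
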